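(* Let $\mathcal I$ be a CSP instance in which the domain of every variable is the $8$-element dihedral group $\mathbf D_4$ (the symmetry group of a square) and every constraint is of the form $x_1x_2\dots x_n\in R$, where $R$ is a coset of a subgroup of $\mathbf D_4^n$. Let $\mathcal D=\mathrm{lc}(\mathcal I)$ be the associated LC instance, with variable set $X$. Suppose that there exist $N\in\mathbb N$, a vector $\mathbf i\in\mathbb Z_2^N$, and functions $\mathbf v_x:\mathcal D_x\to\mathbb Z_2^N$ ($x\in X$) such that: (1) the sum of the coordinates of $\mathbf i$ is $1$ in $\mathbb Z_2$, and $\sum_{a\in\mathcal D_x}\mathbf v_x(a)=\mathbf i$ for every $x\in X$; (2) $\mathbf v_x(a)\cdot\mathbf v_x(b)=0$ for every $x\in X$ and all distinct $a,b\in\mathcal D_x$, where $\cdot$ is the standard dot product on $\mathbb Z_2^N$; (3) for every constraint $x=\alpha(y)$ of $\mathcal D$ and every $a\in\mathcal D_x$, $\mathbf v_x(a)=\sum_{b\in\alpha^{-1}(a)}\mathbf v_y(b)$ in $\mathbb Z_2^N$. Then $\mathcal I$ has a solution.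
   Context: A CSP instance $\mathcal I$ consists of a finite set of variables, a finite domain for each variable, and a finite list of constraints $x_1x_2\dots x_n\in R$, where $R$ is a subset of the product of the domains of $x_1,\dots,x_n$ (the arity $n$ may depend on the constraint). A solution assigns to each variable an element of its domain so that, for each constraint, the tuple of values of $x_1,\dots,x_n$ lies in $R$. An LC (label cover) instance $\mathcal D$ consists of a finite set $X$ of variables, a finite set $\mathcal D_x$ (domain) for each $x\in X$, and a finite list of constraints of the form $x=\alpha(y)$ with $x,y\in X$ and $\alpha:\mathcal D_y\to\mathcal D_x$ a function. The LC instance $\mathrm{lc}(\mathcal I)$ associated with a CSP instance $\mathcal I$ has as variables the variables of $\mathcal I$, with the same domains, together with one additional variable for each constraint of $\mathcal I$: for a constraint $x_1x_2\dots x_n\in R$ the new variable $y$ has domain $R$, and one imposes the constraints $x_i=\pi_i(y)$ for $i=1,\dots,n$, where $\pi_i:R\to\mathbf D_4$ is the projection to the $i$-th coordinate. *)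

theory Defs
  imports "HOL-Algebra.Algebra" "HOL-Library.Z2"
begin

section \<open>The dihedral group of order 8\<close>

text \<open>The vertices of the square are numbered 1, 2, 3, 4 in cyclic order; a symmetry of the square
  is identified with the permutation it induces on the vertices.\<close>

definition square_edges :: "nat set set" where
  "square_edges = {{1, 2}, {2, 3}, {3, 4}, {4, 1}}"

definition D4 :: "(nat \<Rightarrow> nat) monoid" where
  "D4 = (sym_group 4) \<lparr>carrier :=
     {p \<in> carrier (sym_group 4). (\<lambda>E. p ` E) ` square_edges = square_edges}\<rparr>"

lemma subgroup_D4: "subgroup (carrier D4) (sym_group 4)"
proof -
  interpret S: group "sym_group 4" by (rule sym_group_is_group)
  have comp: "(\<lambda>E. (p \<circ> q) ` E) ` square_edges = square_edges"
    if "(\<lambda>E. p ` E) ` square_edges = square_edges"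
       "(\<lambda>E. q ` E) ` square_edges = square_edges" for p q :: "nat \<Rightarrow> nat"
  proof -
    have "(\<lambda>E. (p \<circ> q) ` E) ` square_edges = (\<lambda>E. p ` E) ` ((\<lambda>E. q ` E) ` square_edges)"
      by (simp add: image_comp comp_def)
    with that show ?thesis by simp
  qed
  show ?thesis
  proof (rule S.subgroupI)
    show "carrier D4 \<subseteq> carrier (sym_group 4)" by (auto simp: D4_def)
    have "id \<in> carrier D4"
      by (auto simp: D4_def sym_group_carrier permutes_id)
    then show "carrier D4 \<noteq> {}" by blast
    fix p assume p: "p \<in> carrier D4"
    then have pc: "p \<in> carrier (sym_group 4)" by (simp add: D4_def)
    define q where "q = inv\<^bsub>sym_group 4\<^esub> p"
    have qc: "q \<in> carrier (sym_group 4)" using S.inv_closed[OF pc] by (simp only: q_def)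
    have "q \<otimes>\<^bsub>sym_group 4\<^esub> p = \<one>\<^bsub>sym_group 4\<^esub>"
      unfolding q_def by (rule S.l_inv[OF pc])
    then have "q \<circ> p = id" by (simp add: sym_group_def)
    then have qp: "q ` (p ` E) = E" for E by (simp add: image_comp)
    have "(\<lambda>E. q ` E) ` square_edges = (\<lambda>E. q ` E) ` ((\<lambda>E. p ` E) ` square_edges)"
      using p by (simp add: D4_def)
    also have "\<dots> = (\<lambda>E. q ` (p ` E)) ` square_edges" by blast
    also have "\<dots> = square_edges" by (simp add: qp)
    finally show "inv\<^bsub>sym_group 4\<^esub> p \<in> carrier D4"
      using qc by (simp add: D4_def flip: q_def)
  next
    fix p q assume "p \<in> carrier D4" "q \<in> carrier D4"
    then show "p \<otimes>\<^bsub>sym_group 4\<^esub> q \<in> carrier D4"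
      using S.m_closed[of p q] comp[of p q] by (simp add: D4_def sym_group_mult)
  qed
qed

lemma group_D4: "group D4"
proof -
  interpret S: group "sym_group 4" by (rule sym_group_is_group)
  have "D4 = (sym_group 4)\<lparr>carrier := carrier D4\<rparr>" by (simp add: D4_def)
  with S.subgroup_imp_group[OF subgroup_D4] show ?thesis by simp
qed

lemma order_D4: "order D4 = 8"
proof -
  define g where "g = (\<lambda>xs i. if i \<in> {1..4::nat} then xs ! (i - 1) else (i::nat))"
  define L :: "nat list set" where "L = {[1,2,3,4], [2,3,4,1], [3,4,1,2], [4,1,2,3],
             [4,3,2,1], [3,2,1,4], [2,1,4,3], [1,4,3,2]}"
  have I: "{1..4::nat} = {1,2,3,4}" by auto
  have g: "g [a,b,c,d] 1 = a" "g [a,b,c,d] 2 = b" "g [a,b,c,d] 3 = c" "g [a,b,c,d] 4 = d"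
    for a b c d by (simp_all add: g_def)
  have sub: "p \<in> g ` L" if p: "p \<in> carrier D4" for p
  proof -
    from p have perm: "p permutes {1..4}" and
      edges: "(\<lambda>E. p ` E) ` square_edges = square_edges"
      by (auto simp: D4_def sym_group_def)
    have out: "p i = i" if "i \<notin> {1..4}" for i using perm that by (rule permutes_not_in)
    have inj: "p i = p j \<longleftrightarrow> i = j" for i j using permutes_inj[OF perm] by (simp add: inj_eq)
    have dist: "distinct [p 1, p 2, p 3, p 4]" by (simp add: inj)
    have e: "{p a, p b} \<in> square_edges" if "{a, b} \<in> square_edges" for a b
    proof -
      have "p ` {a, b} \<in> square_edges" using edges that by blast
      then show ?thesis by simp
    qed
    have adj: "a = 1 \<and> b = 2 \<or> a = 2 \<and> b = 1 \<or> a = 2 \<and> b = 3 \<or> a = 3 \<and> b = 2 \<or>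
               a = 3 \<and> b = 4 \<or> a = 4 \<and> b = 3 \<or> a = 4 \<and> b = 1 \<or> a = 1 \<and> b = 4"
      if "{a, b} \<in> square_edges" for a b
      using that unfolding square_edges_def insert_iff empty_iff doubleton_eq_iff by blast
    have "[p 1, p 2, p 3, p 4] \<in> L"
      using adj[OF e[of 1 2]] adj[OF e[of 2 3]] adj[OF e[of 3 4]] dist
      unfolding L_def square_edges_def
      by (simp only: insert_iff empty_iff list.inject distinct.simps list.set) presburger
    moreover have "p = g [p 1, p 2, p 3, p 4]"
    proof
      fix i show "p i = g [p 1, p 2, p 3, p 4] i"
      proof (cases "i \<in> {1..4}")
        case True
        then have "i = 1 \<or> i = 2 \<or> i = 3 \<or> i = 4" by auto
        then show ?thesis using g by metis
      qed (auto simp: out g_def)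
    qed
    ultimately show ?thesis by blast
  qed
  have sup: "g xs \<in> carrier D4" if xs: "xs \<in> L" for xs
  proof -
    obtain a b c d where abcd: "xs = [a,b,c,d]" using xs by (auto simp: L_def)
    have "{a,b,c,d} = {1,2,3,4}" and "distinct [a,b,c,d]"
      and ed: "{{a,b},{b,c},{c,d},{d,a}} = square_edges"
      using xs unfolding abcd L_def square_edges_def by (elim insertE emptyE; force)+
    then have "bij_betw (g xs) {1..4} {1..4}"
      unfolding bij_betw_def I abcd inj_on_def
      by (auto simp: g g(1)[unfolded One_nat_def])
    then have "g xs permutes {1..4}" by (rule bij_imp_permutes) (auto simp: g_def)
    moreover have "(\<lambda>E. g xs ` E) ` square_edges = square_edges"
      by (subst square_edges_def) (simp only: abcd image_insert image_empty g ed)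
    ultimately show ?thesis by (simp add: D4_def sym_group_def)
  qed
  have "carrier D4 = g ` L" using sub sup by blast
  moreover have "inj_on g L"
  proof (rule inj_onI)
    fix xs ys assume xy: "xs \<in> L" "ys \<in> L" and eq: "g xs = g ys"
    have "length xs = 4" "length ys = 4" using xy by (auto simp: L_def)
    moreover have "xs ! i = ys ! i" if "i < 4" for i
      using fun_cong[OF eq, of "Suc i"] that by (simp add: g_def)
    ultimately show "xs = ys" by (simp add: list_eq_iff_nth_eq)
  qed
  moreover have "card L = 8" by (simp add: L_def)
  ultimately show ?thesis by (simp add: order_def card_image)
qed

section \<open>CSP instances\<close>

text \<open>A constraint \<open>x\<^sub>1 \<dots> x\<^sub>n \<in> R\<close> is a pair \<open>(xs, R)\<close> of the list of
  its variables (repetitions allowed) and a set of \<open>n\<close>-tuples. Coordinates are counted from 0,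
  and an \<open>n\<close>-tuple is an extensional function on \<open>{..<n}\<close>, as in the library's product groups.\<close>

type_synonym ('v, 'a) csp_constraint = "'v list \<times> (nat \<Rightarrow> 'a) set"

record ('v, 'a) csp =
  csp_vars :: "'v set"
  csp_dom :: "'v \<Rightarrow> 'a set"
  csp_cons :: "('v, 'a) csp_constraint list"

definition csp_instance :: "('v, 'a) csp \<Rightarrow> bool" where
  "csp_instance I \<longleftrightarrow>
     finite (csp_vars I) \<and>
     (\<forall>x\<in>csp_vars I. finite (csp_dom I x)) \<and>
     (\<forall>(xs, R)\<in>set (csp_cons I).
        set xs \<subseteq> csp_vars I \<and> R \<subseteq> (\<Pi>\<^sub>E i\<in>{..<length xs}. csp_dom I (xs ! i)))"

definition csp_solution :: "('v, 'a) csp \<Rightarrow> ('v \<Rightarrow> 'a) \<Rightarrow> bool" where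
  "csp_solution I s \<longleftrightarrow>
     (\<forall>x\<in>csp_vars I. s x \<in> csp_dom I x) \<and>
     (\<forall>(xs, R)\<in>set (csp_cons I). (\<lambda>i\<in>{..<length xs}. s (xs ! i)) \<in> R)"

text \<open>Left and right cosets are both allowed; since a left coset of \<open>H\<close> is a right coset of
  a conjugate of \<open>H\<close>, this is the same class of sets as either kind alone.\<close>

definition is_coset :: "('a, 'b) monoid_scheme \<Rightarrow> 'a set \<Rightarrow> bool" where
  "is_coset G R \<longleftrightarrow> (\<exists>H. subgroup H G \<and> (R \<in> rcosets\<^bsub>G\<^esub> H \<or> R \<in> lcosets\<^bsub>G\<^esub> H))"

definition D4_coset_csp :: "('v, nat \<Rightarrow> nat) csp \<Rightarrow> bool" where
  "D4_coset_csp I \<longleftrightarrow>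
     (\<forall>x\<in>csp_vars I. csp_dom I x = carrier D4) \<and>
     (\<forall>(xs, R)\<in>set (csp_cons I). is_coset (product_group {..<length xs} (\<lambda>_. D4)) R)"

section \<open>Label cover instances\<close>

text \<open>A constraint \<open>x = \<alpha>(y)\<close> is the triple \<open>(x, \<alpha>, y)\<close>; only the values of \<open>\<alpha>\<close> on the domain
  of \<open>y\<close> matter.\<close>

record ('x, 'd) lc =
  lc_vars :: "'x set"
  lc_dom :: "'x \<Rightarrow> 'd set"
  lc_cons :: "('x \<times> ('d \<Rightarrow> 'd) \<times> 'x) list"

definition lc_instance :: "('x, 'd) lc \<Rightarrow> bool" where
  "lc_instance D \<longleftrightarrow>
     finite (lc_vars D) \<and>
     (\<forall>x\<in>lc_vars D. finite (lc_dom D x)) \<and>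
     (\<forall>(x, \<alpha>, y)\<in>set (lc_cons D).
        x \<in> lc_vars D \<and> y \<in> lc_vars D \<and> \<alpha> \<in> lc_dom D y \<rightarrow> lc_dom D x)"

text \<open>In the label cover instance of a CSP instance, \<open>Inl x\<close> is the original variable \<open>x\<close>, with
  values \<open>Inl a\<close>, and \<open>Inr k\<close> is the variable of the \<open>k\<close>-th constraint, with values \<open>Inr t\<close> for the
  tuples \<open>t\<close> of its relation.\<close>

definition lc_of :: "('v, 'a) csp \<Rightarrow> ('v + nat, 'a + (nat \<Rightarrow> 'a)) lc" where
  "lc_of I = \<lparr>
     lc_vars = csp_vars I <+> {..<length (csp_cons I)},
     lc_dom = (\<lambda>z. case z of Inl x \<Rightarrow> Inl ` csp_dom I x | Inr k \<Rightarrow> Inr ` snd (csp_cons I ! k)),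
     lc_cons = concat (map (\<lambda>k. let xs = fst (csp_cons I ! k) in
                  map (\<lambda>i. (Inl (xs ! i), \<lambda>b. Inl (projr b i), Inr k)) [0..<length xs])
                [0..<length (csp_cons I)])\<rparr>"

lemma lc_instance_lc_of:
  assumes "csp_instance I"
  shows "lc_instance (lc_of I)"
proof -
  have R: "set (fst c) \<subseteq> csp_vars I"
          "snd c \<subseteq> (\<Pi>\<^sub>E i\<in>{..<length (fst c)}. csp_dom I (fst c ! i))"
    if "c \<in> set (csp_cons I)" for c
    using assms that by (cases c; force simp: csp_instance_def)+
  have fin: "finite (snd c)" if c: "c \<in> set (csp_cons I)" for c
  proof (rule finite_subset[OF R(2)[OF c]])
    show "finite (\<Pi>\<^sub>E i\<in>{..<length (fst c)}. csp_dom I (fst c ! i))"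
      using R(1)[OF c] assms
      by (intro finite_PiE) (auto simp: csp_instance_def intro: subsetD[OF _ nth_mem])
  qed
  have "finite (lc_dom (lc_of I) z)" if "z \<in> lc_vars (lc_of I)" for z
    using that assms fin[OF nth_mem] by (auto simp: lc_of_def csp_instance_def)
  moreover have "finite (lc_vars (lc_of I))"
    using assms by (simp add: lc_of_def csp_instance_def)
  moreover have "x \<in> lc_vars (lc_of I) \<and> y \<in> lc_vars (lc_of I) \<and>
      \<alpha> \<in> lc_dom (lc_of I) y \<rightarrow> lc_dom (lc_of I) x"
    if "(x, \<alpha>, y) \<in> set (lc_cons (lc_of I))" for x \<alpha> y
  proof -
    from that obtain k i where k: "k < length (csp_cons I)"
      and i: "i < length (fst (csp_cons I ! k))"
      and e: "x = Inl (fst (csp_cons I ! k) ! i)" "\<alpha> = (\<lambda>b. Inl (projr b i))" "y = Inr k"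
      by (auto simp: lc_of_def Let_def)
    have c: "csp_cons I ! k \<in> set (csp_cons I)" using k by simp
    have "fst (csp_cons I ! k) ! i \<in> csp_vars I" using R(1)[OF c] i by auto
    moreover have "t i \<in> csp_dom I (fst (csp_cons I ! k) ! i)" if "t \<in> snd (csp_cons I ! k)" for t
      using R(2)[OF c] that i by auto
    ultimately show ?thesis using k e by (auto simp: lc_of_def)
  qed
  ultimately show ?thesis unfolding lc_instance_def by blast
qed

section \<open>Vector assignments over the two-element field\<close>

text \<open>A vector in \<open>\<int>\<^sub>2\<^sup>N\<close> is a function \<open>nat \<Rightarrow> bit\<close>, of which only the values on \<open>{..<N}\<close> matter;
  all vector equations are stated coordinatewise.\<close>

definition Z2_dot :: "nat \<Rightarrow> (nat \<Rightarrow> bit) \<Rightarrow> (nat \<Rightarrow> bit) \<Rightarrow> bit" where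
  "Z2_dot N u w = (\<Sum>j<N. u j * w j)"

definition Z2_vector_assignment ::
  "('x, 'd) lc \<Rightarrow> nat \<Rightarrow> (nat \<Rightarrow> bit) \<Rightarrow> ('x \<Rightarrow> 'd \<Rightarrow> nat \<Rightarrow> bit) \<Rightarrow> bool" where
  "Z2_vector_assignment D N vi v \<longleftrightarrow>
     (\<Sum>j<N. vi j) = 1 \<and>
     (\<forall>x\<in>lc_vars D. \<forall>j<N. (\<Sum>a\<in>lc_dom D x. v x a j) = vi j) \<and>
     (\<forall>x\<in>lc_vars D. \<forall>a\<in>lc_dom D x. \<forall>b\<in>lc_dom D x. a \<noteq> b \<longrightarrow> Z2_dot N (v x a) (v x b) = 0) \<and>
     (\<forall>(x, \<alpha>, y)\<in>set (lc_cons D). \<forall>a\<in>lc_dom D x. \<forall>j<N.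
        v x a j = (\<Sum>b\<in>{b\<in>lc_dom D y. \<alpha> b = a}. v y b j))"

end

theory Submission
  imports Defs
begin

text \<open>The group \<open>D\<^sub>4\<close> is the set \<open>\<int>\<^sub>2\<^sup>3\<close> of triples \<open>(A, B, C)\<close> in which \<open>A\<close> and \<open>B\<close> are additive and
  \<open>C (x y) = C x + C y + A x B y\<close>. In an instance with vectors \<open>w t\<close> on the values \<open>t\<close> of a variable
  and a base point \<open>h\<close>, consider the product of \<open>h\<close> and all \<open>h\<inverse> t\<close> with \<open>w t j = 1\<close>, over all
  coordinates \<open>j\<close> and all values \<open>t\<close>, in a fixed order. It stays in every coset that contains \<open>h\<close>
  and the \<open>t\<close>. In its third coordinate the terms \<open>A t B t'\<close> from a common \<open>j\<close> have total
  coefficient \<open>w t \<bullet> w t' = 0\<close>; what remains depends only on \<open>A h\<close>, \<open>B h\<close> and on the marginals of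
  \<open>w\<close>, so the products formed in a constraint and in its variables agree. Base points with equal
  \<open>A\<close> and \<open>B\<close> are supplied by the same construction.\<close>

section \<open>Ordered products in a group\<close>

definition list_mult :: "('a, 'b) monoid_scheme \<Rightarrow> 'a list \<Rightarrow> 'a" where
  "list_mult G xs = foldr (\<otimes>\<^bsub>G\<^esub>) xs \<one>\<^bsub>G\<^esub>"

lemma list_mult_Nil [simp]: "list_mult G [] = \<one>\<^bsub>G\<^esub>"
  and list_mult_Cons [simp]: "list_mult G (x # xs) = x \<otimes>\<^bsub>G\<^esub> list_mult G xs"
  by (simp_all add: list_mult_def)

lemma (in monoid) list_mult_closed:
  "set xs \<subseteq> carrier G \<Longrightarrow> list_mult G xs \<in> carrier G"
  by (induction xs) auto

lemma (in monoid) list_mult_snoc: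
  assumes "set xs \<subseteq> carrier G" "x \<in> carrier G"
  shows "list_mult G (xs @ [x]) = list_mult G xs \<otimes> x"
  using assms by (induction xs) (auto simp: m_assoc list_mult_closed)

text \<open>The exponent only chooses between \<open>x\<close> and the identity: since
  \<open>x\<close> may have order 4, this is in general not a homomorphism in
  \<open>b\<close>.\<close>

definition bit_pow :: "('a, 'b) monoid_scheme \<Rightarrow> 'a \<Rightarrow> bit \<Rightarrow> 'a" where
  "bit_pow G x b = (if b = 1 then x else \<one>\<^bsub>G\<^esub>)"

definition block :: "('a, 'b) monoid_scheme \<Rightarrow> 't list \<Rightarrow> ('t \<Rightarrow> bit) \<Rightarrow> ('t \<Rightarrow> 'a) \<Rightarrow> 'a" where
  "block G ts u q = list_mult G (map (\<lambda>t. bit_pow G (q t) (u t)) ts)"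

text \<open>Values are written \<open>p t\<close> so that one list of tuples serves both for a
  product group, with \<open>p = id\<close>, and for its \<open>i\<close>-th factor, with
  \<open>p = (\<lambda>t. t i)\<close>.\<close>

definition word ::
  "('a, 'b) monoid_scheme \<Rightarrow> nat \<Rightarrow> 't list \<Rightarrow> ('t \<Rightarrow> nat \<Rightarrow> bit) \<Rightarrow> ('t \<Rightarrow> 'a) \<Rightarrow> 'a \<Rightarrow> 'a" where
  "word G N ts w p h = h \<otimes>\<^bsub>G\<^esub> list_mult G
     (map (\<lambda>j. block G ts (\<lambda>t. w t j) (\<lambda>t. inv\<^bsub>G\<^esub> h \<otimes>\<^bsub>G\<^esub> p t)) [0..<N])"

context group
begin

lemma bit_pow_closed: "x \<in> carrier G \<Longrightarrow> bit_pow G x b \<in> carrier G"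
  by (simp add: bit_pow_def)

lemma block_closed: "q ` set ts \<subseteq> carrier G \<Longrightarrow> block G ts u q \<in> carrier G"
  unfolding block_def by (rule list_mult_closed) (auto intro: bit_pow_closed)

lemma word_closed:
  assumes "h \<in> carrier G" "p ` set ts \<subseteq> carrier G"
  shows "word G N ts w p h \<in> carrier G"
  unfolding word_def using assms
  by (auto simp: image_subset_iff intro!: m_closed list_mult_closed block_closed)

lemma list_mult_stable:
  assumes "R \<subseteq> carrier G" "y \<in> R" "\<And>x. x \<in> set xs \<Longrightarrow> x \<in> carrier G \<and> (\<forall>y\<in>R. y \<otimes> x \<in> R)"
  shows "y \<otimes> list_mult G xs \<in> R"
  using assms(2,3)
proof (induction xs arbitrary: y)
  case Nil
  then show ?case using assms(1) by auto
next
  case (Cons x xs)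
  then have "y \<otimes> (x \<otimes> list_mult G xs) = (y \<otimes> x) \<otimes> list_mult G xs"
    using assms(1) by (subst m_assoc) (auto intro!: list_mult_closed)
  then show ?case using Cons by simp
qed

text \<open>Right multiplication by \<open>inv h \<otimes> p t\<close> maps \<open>R\<close> into
  itself, by the closure hypothesis with \<open>y = h\<close>. Hence so does each block, and so does
  the product of all blocks, here applied to \<open>h\<close>.\<close>

lemma word_in_coset:
  assumes "R \<subseteq> carrier G" "\<And>x y z. x \<in> R \<Longrightarrow> y \<in> R \<Longrightarrow> z \<in> R \<Longrightarrow> x \<otimes> (inv y \<otimes> z) \<in> R"
    and "h \<in> R" "p ` set ts \<subseteq> R"
  shows "word G N ts w p h \<in> R"
proof -
  let ?stable = "\<lambda>x. x \<in> carrier G \<and> (\<forall>y\<in>R. y \<otimes> x \<in> R)"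
  have 1: "?stable (bit_pow G (inv h \<otimes> p t) b)" if "t \<in> set ts" for t b
    using assms that by (auto simp: bit_pow_def subset_iff image_subset_iff)
  have "?stable (block G ts u (\<lambda>t. inv h \<otimes> p t))" for u
    unfolding block_def using 1 list_mult_stable[OF assms(1)]
    by (auto intro!: list_mult_closed list_mult_stable[OF assms(1)])
  then show ?thesis
    unfolding word_def by (intro list_mult_stable assms) auto
qed

end

text \<open>The ternary operation treats left and right cosets alike: of the three copies of
  \<open>g\<close>, two cancel and one remains on its own side.\<close>

lemma coset_mult_inv_mult:
  fixes G (structure)
  assumes "group G" "is_coset G R"
  shows "R \<subseteq> carrier G" "R \<noteq> {}"
    "\<And>x y z. x \<in> R \<Longrightarrow> y \<in> R \<Longrightarrow> z \<in> R \<Longrightarrow> x \<otimes> (inv y \<otimes> z) \<in> R"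
proof -
  interpret group G by fact
  obtain H g where H: "subgroup H G" and g: "g \<in> carrier G" and R: "R = H #> g \<or> R = g <# H"
    using assms(2) by (auto simp: is_coset_def RCOSETS_def LCOSETS_def)
  interpret H: subgroup H G by fact
  show "R \<subseteq> carrier G"
    using R g by (auto simp: r_coset_def l_coset_def)
  show "R \<noteq> {}"
    using R H.one_closed unfolding r_coset_def l_coset_def by blast
  fix x y z assume xyz: "x \<in> R" "y \<in> R" "z \<in> R"
  from R show "x \<otimes> (inv y \<otimes> z) \<in> R"
  proof
    assume R: "R = H #> g"
    then obtain a b c where abc: "a \<in> H" "b \<in> H" "c \<in> H" "x = a \<otimes> g" "y = b \<otimes> g" "z = c \<otimes> g"
      using xyz by (auto simp: r_coset_def)
    then have "x \<otimes> (inv y \<otimes> z) = (a \<otimes> inv b \<otimes> c) \<otimes> g"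
      using g by (simp add: m_assoc inv_mult_group inv_solve_left) (simp add: m_assoc[symmetric])
    then show ?thesis using R abc by (auto simp: r_coset_def)
  next
    assume R: "R = g <# H"
    then obtain a b c where abc: "a \<in> H" "b \<in> H" "c \<in> H" "x = g \<otimes> a" "y = g \<otimes> b" "z = g \<otimes> c"
      using xyz by (auto simp: l_coset_def)
    then have "x \<otimes> (inv y \<otimes> z) = g \<otimes> (a \<otimes> (inv b \<otimes> c))"
      using g by (simp add: m_assoc inv_mult_group) (simp add: m_assoc[symmetric])
    then show ?thesis using R abc by (auto simp: l_coset_def)
  qed
qed

lemma list_mult_product_group:
  assumes "i \<in> I"
  shows "list_mult (product_group I G) xs i = list_mult (G i) (map (\<lambda>x. x i) xs)"
  using assms by (induction xs) auto

lemma word_product_group: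
  assumes "i \<in> I" "\<And>i. i \<in> I \<Longrightarrow> group (G i)" "h \<in> carrier (product_group I G)"
  shows "word (product_group I G) N ts w p h i = word (G i) N ts w (\<lambda>t. p t i) (h i)"
  using assms
  by (auto simp: word_def block_def list_mult_product_group bit_pow_def if_distrib
      comp_def cong: if_cong intro!: arg_cong2[where f = "monoid.mult (G i)"] arg_cong[where f = "list_mult (G i)"])

section \<open>Coordinates with a bilinear cocycle\<close>

text \<open>By default the simplifier turns sums and products of bits into bitwise operations, to which the
  ring lemmas do not apply.\<close>

declare add_bit_eq_xor [simp del] mult_bit_eq_and [simp del]

lemma bit_double [simp]: "(x::bit) + x = 0" "x + (x + y) = y"
  by (cases x; cases y; simp)+

text \<open>This is the law of upper unitriangular 3 x 3 matrices over the two-element field, with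
  \<open>A\<close> and \<open>B\<close> next to the diagonal and \<open>C\<close> in the corner;
  \<open>coords_inject\<close> makes \<open>G\<close> embed in that group.\<close>

locale bilinear_coords = group G for G (structure) +
  fixes A B C :: "'a \<Rightarrow> bit"
  assumes A_mult: "\<lbrakk>x \<in> carrier G; y \<in> carrier G\<rbrakk> \<Longrightarrow> A (x \<otimes> y) = A x + A y"
    and B_mult: "\<lbrakk>x \<in> carrier G; y \<in> carrier G\<rbrakk> \<Longrightarrow> B (x \<otimes> y) = B x + B y"
    and C_mult: "\<lbrakk>x \<in> carrier G; y \<in> carrier G\<rbrakk> \<Longrightarrow> C (x \<otimes> y) = C x + C y + A x * B y"
    and coords_inject:
      "\<lbrakk>x \<in> carrier G; y \<in> carrier G; A x = A y; B x = B y; C x = C y\<rbrakk> \<Longrightarrow> x = y"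
begin

lemma coords_one: "A \<one> = 0" "B \<one> = 0" "C \<one> = 0"
  using A_mult[of \<one> \<one>] B_mult[of \<one> \<one>] C_mult[of \<one> \<one>] by auto

lemma coords_inv:
  assumes "x \<in> carrier G"
  shows "A (inv x) = A x" "B (inv x) = B x" "C (inv x) = C x + A x * B x"
proof -
  show AB: "A (inv x) = A x" "B (inv x) = B x"
    using A_mult[of "inv x" x] B_mult[of "inv x" x] assms by (auto simp: coords_one add_eq_0_iff)
  have "C (inv x) + C x + A x * B x = 0"
    using C_mult[of "inv x" x] assms by (simp add: coords_one AB)
  then show "C (inv x) = C x + A x * B x"
    by (cases "C x"; cases "C (inv x)"; cases "A x"; cases "B x"; simp)
qed

lemma coords_inv_mult:
  assumes "x \<in> carrier G" "y \<in> carrier G"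
  shows "A (inv x \<otimes> y) = A x + A y" "B (inv x \<otimes> y) = B x + B y"
    "C (inv x \<otimes> y) = C x + A x * B x + C y + A x * B y"
  using assms by (simp_all add: A_mult B_mult C_mult coords_inv)

lemma coords_bit_pow:
  "A (bit_pow G x b) = b * A x" "B (bit_pow G x b) = b * B x" "C (bit_pow G x b) = b * C x"
  by (cases b; simp add: bit_pow_def coords_one)+

lemma AB_block:
  assumes "q ` set ts \<subseteq> carrier G" "distinct ts"
  shows "A (block G ts u q) = (\<Sum>t\<in>set ts. u t * A (q t))"
    "B (block G ts u q) = (\<Sum>t\<in>set ts. u t * B (q t))"
proof -
  have "A (block G ts u q) = (\<Sum>t\<in>set ts. u t * A (q t)) \<and>
    B (block G ts u q) = (\<Sum>t\<in>set ts. u t * B (q t))"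
    using assms
  proof (induction ts)
    case Nil
    then show ?case by (simp add: block_def coords_one)
  next
    case (Cons t ts)
    moreover from this have "block G ts u q \<in> carrier G" "bit_pow G (q t) (u t) \<in> carrier G"
      by (auto intro: block_closed bit_pow_closed)
    ultimately show ?case
      by (simp add: block_def A_mult B_mult coords_bit_pow)
  qed
  then show "A (block G ts u q) = (\<Sum>t\<in>set ts. u t * A (q t))"
    "B (block G ts u q) = (\<Sum>t\<in>set ts. u t * B (q t))" by auto
qed

text \<open>A single block may depend on the order of \<open>ts\<close>; the sum over
  \<open>j\<close> does not. Putting \<open>t\<close> in front adds the terms
  \<open>A (q t) * B (q t') * (w t j * w t' j)\<close>, and summing over \<open>j\<close> turns the
  last factor into a vanishing dot product.\<close>

lemma sum_C_block:
  assumes "q ` set ts \<subseteq> carrier G" "distinct ts"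
    and "\<And>t t'. \<lbrakk>t \<in> set ts; t' \<in> set ts; t \<noteq> t'\<rbrakk> \<Longrightarrow> (\<Sum>j<N. w t j * w t' j) = 0"
  shows "(\<Sum>j<N. C (block G ts (\<lambda>t. w t j) q)) = (\<Sum>j<N. \<Sum>t\<in>set ts. w t j * C (q t))"
  using assms
proof (induction ts)
  case Nil
  then show ?case by (simp add: block_def coords_one)
next
  case (Cons t ts)
  have step: "C (block G (t # ts) (\<lambda>t. w t j) q) = w t j * C (q t) + C (block G ts (\<lambda>t. w t j) q)
      + (\<Sum>t'\<in>set ts. A (q t) * B (q t') * (w t j * w t' j))" for j
  proof -
    have "block G ts (\<lambda>t. w t j) q \<in> carrier G" "bit_pow G (q t) (w t j) \<in> carrier G"
      using Cons.prems by (auto intro: block_closed bit_pow_closed)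
    moreover have "block G (t # ts) (\<lambda>t. w t j) q =
        bit_pow G (q t) (w t j) \<otimes> block G ts (\<lambda>t. w t j) q"
      by (simp add: block_def)
    ultimately show ?thesis
      using Cons.prems
      by (simp add: C_mult coords_bit_pow AB_block sum_distrib_left mult_ac)
  qed
  have "(\<Sum>j<N. \<Sum>t'\<in>set ts. A (q t) * B (q t') * (w t j * w t' j)) =
      (\<Sum>t'\<in>set ts. A (q t) * B (q t') * (\<Sum>j<N. w t j * w t' j))"
    by (subst sum.swap) (simp add: sum_distrib_left)
  also have "\<dots> = 0"
    using Cons.prems by (intro sum.neutral) auto
  finally show ?case
    using Cons by (simp add: step sum.distrib)
qed

text \<open>Cross terms between different blocks survive in \<open>C\<close>, but they see the
  blocks only through \<open>A\<close> and \<open>B\<close>.\<close>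

lemma coords_list_mult_upt:
  assumes "\<And>j. j < N \<Longrightarrow> b j \<in> carrier G"
  shows "A (list_mult G (map b [0..<N])) = (\<Sum>j<N. A (b j))"
    "B (list_mult G (map b [0..<N])) = (\<Sum>j<N. B (b j))"
    "C (list_mult G (map b [0..<N])) = (\<Sum>j<N. C (b j)) + (\<Sum>j<N. (\<Sum>i<j. A (b i)) * B (b j))"
proof -
  have "A (list_mult G (map b [0..<N])) = (\<Sum>j<N. A (b j)) \<and>
    B (list_mult G (map b [0..<N])) = (\<Sum>j<N. B (b j)) \<and>
    C (list_mult G (map b [0..<N])) = (\<Sum>j<N. C (b j)) + (\<Sum>j<N. (\<Sum>i<j. A (b i)) * B (b j))"
    using assms
  proof (induction N)
    case 0
    then show ?case by (simp add: coords_one)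
  next
    case (Suc N)
    have "set (map b [0..<N]) \<subseteq> carrier G" "b N \<in> carrier G"
      using Suc.prems by auto
    moreover from this have "list_mult G (map b [0..<N]) \<in> carrier G"
      by (intro list_mult_closed)
    ultimately show ?case
      using Suc by (simp add: list_mult_snoc A_mult B_mult C_mult add_ac)
  qed
  then show "A (list_mult G (map b [0..<N])) = (\<Sum>j<N. A (b j))"
    "B (list_mult G (map b [0..<N])) = (\<Sum>j<N. B (b j))"
    "C (list_mult G (map b [0..<N])) = (\<Sum>j<N. C (b j)) + (\<Sum>j<N. (\<Sum>i<j. A (b i)) * B (b j))"
    by auto
qed

text \<open>The base point drops out: it occurs once in front and, as the weights total 1, once more
  through the factors \<open>inv h \<otimes> p t\<close>.\<close>

lemma AB_word:
  assumes "h \<in> carrier G" "p ` set ts \<subseteq> carrier G" "distinct ts"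
    and "(\<Sum>j<N. \<Sum>t\<in>set ts. w t j) = 1"
  shows "A (word G N ts w p h) = (\<Sum>j<N. \<Sum>t\<in>set ts. w t j * A (p t))"
    "B (word G N ts w p h) = (\<Sum>j<N. \<Sum>t\<in>set ts. w t j * B (p t))"
proof -
  have q: "(\<lambda>t. inv h \<otimes> p t) ` set ts \<subseteq> carrier G" using assms by auto
  have s: "(\<Sum>j<N. \<Sum>t\<in>set ts. w t j * c) = c" for c
    using assms(4) by (simp flip: sum_distrib_right)
  have pc: "p t \<in> carrier G" if "t \<in> set ts" for t using assms that by auto
  show "A (word G N ts w p h) = (\<Sum>j<N. \<Sum>t\<in>set ts. w t j * A (p t))"
    "B (word G N ts w p h) = (\<Sum>j<N. \<Sum>t\<in>set ts. w t j * B (p t))"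
    using assms q unfolding word_def
    by (simp_all add: A_mult B_mult list_mult_closed block_closed coords_list_mult_upt AB_block
        coords_inv pc distrib_left sum.distrib s image_subset_iff)
qed

text \<open>Here \<open>C h\<close> cancels for the same reason, which leaves \<open>h\<close>
  visible only through \<open>A h\<close> and \<open>B h\<close>. The three lines on the right come
  from \<open>h\<close> and the single blocks, from pairs of different blocks, and from
  \<open>h\<close> against all blocks.\<close>

lemma C_word:
  assumes "h \<in> carrier G" "p ` set ts \<subseteq> carrier G" "distinct ts"
    and "(\<Sum>j<N. \<Sum>t\<in>set ts. w t j) = 1"
    and "\<And>t t'. \<lbrakk>t \<in> set ts; t' \<in> set ts; t \<noteq> t'\<rbrakk> \<Longrightarrow> (\<Sum>j<N. w t j * w t' j) = 0"
  shows "C (word G N ts w p h) = A h * B h + (\<Sum>j<N. \<Sum>t\<in>set ts. w t j * (C (p t) + A h * B (p t)))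
      + (\<Sum>j<N. (\<Sum>i<j. \<Sum>t\<in>set ts. w t i * (A h + A (p t))) * (\<Sum>t\<in>set ts. w t j * (B h + B (p t))))
      + A h * (\<Sum>j<N. \<Sum>t\<in>set ts. w t j * (B h + B (p t)))"
proof -
  have q: "(\<lambda>t. inv h \<otimes> p t) ` set ts \<subseteq> carrier G" using assms by auto
  have s: "(\<Sum>j<N. \<Sum>t\<in>set ts. w t j * c) = c" for c
    using assms(4) by (simp flip: sum_distrib_right)
  have pc: "p t \<in> carrier G" if "t \<in> set ts" for t using assms that by auto
  have Csum: "(\<Sum>j<N. \<Sum>t\<in>set ts. w t j * C (inv h \<otimes> p t)) =
      C h + A h * B h + (\<Sum>j<N. \<Sum>t\<in>set ts. w t j * (C (p t) + A h * B (p t)))"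
  proof -
    have "(\<Sum>j<N. \<Sum>t\<in>set ts. w t j * C (inv h \<otimes> p t)) =
      (\<Sum>j<N. \<Sum>t\<in>set ts. w t j * (C h + A h * B h) + w t j * (C (p t) + A h * B (p t)))"
      using assms(1) pc by (intro sum.cong) (auto simp: coords_inv_mult algebra_simps)
    then show ?thesis by (simp add: sum.distrib s del: add.assoc)
  qed
  have ab: "A (block G ts u (\<lambda>t. inv h \<otimes> p t)) = (\<Sum>t\<in>set ts. u t * (A h + A (p t)))"
     "B (block G ts u (\<lambda>t. inv h \<otimes> p t)) = (\<Sum>t\<in>set ts. u t * (B h + B (p t)))" for u
    using assms(1) q pc assms(3) by (simp_all add: AB_block coords_inv_mult)
  have bl: "block G ts u (\<lambda>t. inv h \<otimes> p t) \<in> carrier G" for u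
    using q by (rule block_closed)
  then have lm: "list_mult G (map (\<lambda>j. block G ts (\<lambda>t. w t j) (\<lambda>t. inv h \<otimes> p t)) [0..<N]) \<in> carrier G"
    by (intro list_mult_closed) auto
  have Cb: "(\<Sum>j<N. C (block G ts (\<lambda>t. w t j) (\<lambda>t. inv h \<otimes> p t))) =
      (\<Sum>j<N. \<Sum>t\<in>set ts. w t j * C (inv h \<otimes> p t))"
    using q assms(3,5) by (rule sum_C_block)
  have "C (word G N ts w p h) = C h +
      ((\<Sum>j<N. \<Sum>t\<in>set ts. w t j * C (inv h \<otimes> p t))
       + (\<Sum>j<N. (\<Sum>i<j. \<Sum>t\<in>set ts. w t i * (A h + A (p t))) * (\<Sum>t\<in>set ts. w t j * (B h + B (p t)))))
      + A h * (\<Sum>j<N. \<Sum>t\<in>set ts. w t j * (B h + B (p t)))"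
    unfolding word_def C_mult[OF assms(1) lm] coords_list_mult_upt[OF bl] Cb ab ..
  then show ?thesis unfolding Csum by (simp add: add_ac)
qed

text \<open>Every inner sum in \<open>AB_word\<close> and \<open>C_word\<close> has the form treated
  by \<open>marginal\<close>, so it transfers to the other index list; the two lists need not be
  ordered compatibly.\<close>

lemma word_eq:
  fixes ts :: "'t list" and ts' :: "'s list"
  assumes "h \<in> carrier G" "p ` set ts \<subseteq> carrier G" "distinct ts"
    and "(\<Sum>j<N. \<Sum>t\<in>set ts. w t j) = 1"
    and "\<And>t t'. \<lbrakk>t \<in> set ts; t' \<in> set ts; t \<noteq> t'\<rbrakk> \<Longrightarrow> (\<Sum>j<N. w t j * w t' j) = 0"
    and "h' \<in> carrier G" "p' ` set ts' \<subseteq> carrier G" "distinct ts'"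
    and "\<And>t t'. \<lbrakk>t \<in> set ts'; t' \<in> set ts'; t \<noteq> t'\<rbrakk> \<Longrightarrow> (\<Sum>j<N. w' t j * w' t' j) = 0"
    and marginal: "\<And>f j. j < N \<Longrightarrow>
      (\<Sum>t\<in>set ts. w t j * f (p t)) = (\<Sum>t\<in>set ts'. w' t j * f (p' t))"
    and h: "A h = A h'" "B h = B h'"
  shows "word G N ts w p h = word G N ts' w' p' h'"
proof (rule coords_inject)
  \<comment> \<open>The total weight 1 carries over by taking \<open>f\<close> constantly 1.\<close>
  have 1: "(\<Sum>j<N. \<Sum>t\<in>set ts'. w' t j) = 1"
    using assms(4) marginal[of _ "\<lambda>_. 1"] by simp
  show "word G N ts w p h \<in> carrier G" "word G N ts' w' p' h' \<in> carrier G"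
    using assms by (auto intro: word_closed)
  show "A (word G N ts w p h) = A (word G N ts' w' p' h')"
    using assms(1-8) 1 marginal[of _ A] by (simp add: AB_word)
  show "B (word G N ts w p h) = B (word G N ts' w' p' h')"
    using assms(1-8) 1 marginal[of _ B] by (simp add: AB_word)
  have "(\<Sum>j<N. (\<Sum>i<j. \<Sum>t\<in>set ts. w t i * (A h + A (p t))) * (\<Sum>t\<in>set ts. w t j * (B h + B (p t)))) =
    (\<Sum>j<N. (\<Sum>i<j. \<Sum>t\<in>set ts'. w' t i * (A h + A (p' t))) * (\<Sum>t\<in>set ts'. w' t j * (B h + B (p' t))))"
    using marginal[of _ "\<lambda>x. A h + A x"] marginal[of _ "\<lambda>x. B h + B x"]
    by (intro sum.cong refl arg_cong2[where f = times]) auto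
  moreover note C_word[where N = N and w = w, OF assms(1-5)]
    C_word[where N = N and w = w', OF assms(6-8) 1 assms(9)]
  ultimately show "C (word G N ts w p h) = C (word G N ts' w' p' h')"
    using marginal[of _ "\<lambda>x. C x + A h * B x"] marginal[of _ "\<lambda>x. B h + B x"] h by simp
qed

end

section \<open>Coordinates on the dihedral group\<close>

text \<open>Placing the vertices 1, 2, 3, 4 at \<open>(0,0), (1,0), (1,1), (0,1)\<close> in \<open>\<int>\<^sub>2\<^sup>2\<close>, the symmetries of the
  square are the maps \<open>v \<mapsto> M v + \<tau>\<close> with \<open>M\<close> the identity or the swap of coordinates: \<open>D4_A\<close> tells
  whether \<open>M\<close> is the swap, \<open>D4_B\<close> is \<open>\<tau>\<^sub>1 + \<tau>\<^sub>2\<close>, and \<open>D4_C\<close> is \<open>\<tau>\<^sub>1\<close>.\<close>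

definition D4_A :: "(nat \<Rightarrow> nat) \<Rightarrow> bit" where
  "D4_A p = of_bool ((p 1 \<in> {2, 3}) = (p 2 \<in> {2, 3}))"

definition D4_B :: "(nat \<Rightarrow> nat) \<Rightarrow> bit" where
  "D4_B p = of_bool (p 1 \<in> {2, 4})"

definition D4_C :: "(nat \<Rightarrow> nat) \<Rightarrow> bit" where
  "D4_C p = of_bool (p 1 \<in> {2, 3})"

text \<open>Consecutive vertices go to adjacent ones without repetition, which is a walk around the
  square: four starting points and two directions.\<close>

lemma D4_values:
  assumes "p \<in> carrier D4"
  shows "[p 1, p 2, p 3, p 4] \<in> {[1,2,3,4], [2,3,4,1], [3,4,1,2], [4,1,2,3],
             [4,3,2,1], [3,2,1,4], [2,1,4,3], [1,4,3,2]}"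
proof -
  from assms have perm: "p permutes {1..4}" and
    edges: "(\<lambda>E. p ` E) ` square_edges = square_edges"
    by (auto simp: D4_def sym_group_def)
  have inj: "p i = p j \<longleftrightarrow> i = j" for i j using permutes_inj[OF perm] by (simp add: inj_eq)
  have dist: "distinct [p 1, p 2, p 3, p 4]" by (simp add: inj)
  have e: "{p a, p b} \<in> square_edges" if "{a, b} \<in> square_edges" for a b
  proof -
    have "p ` {a, b} \<in> square_edges" using edges that by blast
    then show ?thesis by simp
  qed
  have adj: "a = 1 \<and> b = 2 \<or> a = 2 \<and> b = 1 \<or> a = 2 \<and> b = 3 \<or> a = 3 \<and> b = 2 \<or>
             a = 3 \<and> b = 4 \<or> a = 4 \<and> b = 3 \<or> a = 4 \<and> b = 1 \<or> a = 1 \<and> b = 4"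
    if "{a, b} \<in> square_edges" for a b
    using that unfolding square_edges_def insert_iff empty_iff doubleton_eq_iff by blast
  show ?thesis
    using adj[OF e[of 1 2]] adj[OF e[of 2 3]] adj[OF e[of 3 4]] dist
    unfolding square_edges_def
    by (simp only: insert_iff empty_iff list.inject distinct.simps list.set) presburger
qed

lemma D4_mult: "x \<otimes>\<^bsub>D4\<^esub> y = x \<circ> y"
  by (simp add: D4_def sym_group_def)

lemma D4_eqI:
  assumes "p \<in> carrier D4" "q \<in> carrier D4" "[p 1, p 2, p 3, p 4] = [q 1, q 2, q 3, q 4]"
  shows "p = q"
proof
  fix i :: nat
  have "p permutes {1..4}" "q permutes {1..4}" using assms by (auto simp: D4_def sym_group_def)
  moreover have "i = 1 \<or> i = 2 \<or> i = 3 \<or> i = 4 \<or> i \<notin> {1..4}" by auto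
  ultimately show "p i = q i" using assms(3) by (auto simp: permutes_not_in)
qed

text \<open>In the composition of \<open>x\<close> and \<open>y\<close>, a swap in \<open>x\<close>
  replaces the first coordinate of the translation of \<open>y\<close> by the second, a change of
  \<open>D4_B y\<close>; this is the cocycle term. The proof runs through all pairs of
  values.\<close>

interpretation D4: bilinear_coords D4 D4_A D4_B D4_C
proof (rule bilinear_coords.intro[OF group_D4], unfold_locales)
  note vals = D4_values[unfolded insert_iff empty_iff list.inject]
  fix x y assume x: "x \<in> carrier D4" and y: "y \<in> carrier D4"
  show "D4_A (x \<otimes>\<^bsub>D4\<^esub> y) = D4_A x + D4_A y"
    using vals[OF x] vals[OF y] unfolding D4_A_def D4_mult comp_def by (elim disjE) simp_all
  show "D4_B (x \<otimes>\<^bsub>D4\<^esub> y) = D4_B x + D4_B y"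
    using vals[OF x] vals[OF y] unfolding D4_B_def D4_mult comp_def by (elim disjE) simp_all
  show "D4_C (x \<otimes>\<^bsub>D4\<^esub> y) = D4_C x + D4_C y + D4_A x * D4_B y"
    using vals[OF x] vals[OF y] unfolding D4_A_def D4_B_def D4_C_def D4_mult comp_def
    by (elim disjE) simp_all
  assume "D4_A x = D4_A y" "D4_B x = D4_B y" "D4_C x = D4_C y"
  then have "[x 1, x 2, x 3, x 4] = [y 1, y 2, y 3, y 4]"
    using vals[OF x] vals[OF y] unfolding D4_A_def D4_B_def D4_C_def
    by (elim disjE) simp_all
  then show "x = y" by (rule D4_eqI[OF x y])
qed

lemma finite_carrier_D4: "finite (carrier D4)"
  using order_D4 by (metis card.infinite order_def zero_neq_numeral)

section \<open>The solution\<close>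

theorem mainTheorem6:
  fixes I :: "('v, nat \<Rightarrow> nat) csp"
  assumes "csp_instance I"
    and "D4_coset_csp I"
    and "\<exists>N vi v. Z2_vector_assignment (lc_of I) N vi v"
  shows "\<exists>s. csp_solution I s"
proof -
  obtain N vi v where va: "Z2_vector_assignment (lc_of I) N vi v"
    using assms(3) by blast
  have dom: "csp_dom I x = carrier D4" if "x \<in> csp_vars I" for x
    using assms(2) that by (auto simp: D4_coset_csp_def)
  have vi: "(\<Sum>j<N. vi j) = 1"
    and va_sum: "\<And>z j. \<lbrakk>z \<in> lc_vars (lc_of I); j < N\<rbrakk> \<Longrightarrow> (\<Sum>a\<in>lc_dom (lc_of I) z. v z a j) = vi j"
    and va_orth: "\<And>z a b. \<lbrakk>z \<in> lc_vars (lc_of I); a \<in> lc_dom (lc_of I) z; b \<in> lc_dom (lc_of I) z; a \<noteq> b\<rbrakk>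
      \<Longrightarrow> (\<Sum>j<N. v z a j * v z b j) = 0"
    and va_marginal: "\<And>z \<alpha> y a j. \<lbrakk>(z, \<alpha>, y) \<in> set (lc_cons (lc_of I)); a \<in> lc_dom (lc_of I) z; j < N\<rbrakk>
      \<Longrightarrow> v z a j = (\<Sum>b\<in>{b\<in>lc_dom (lc_of I) y. \<alpha> b = a}. v y b j)"
    using va unfolding Z2_vector_assignment_def Z2_dot_def by blast+
  have lc_vars: "Inl x \<in> lc_vars (lc_of I) \<longleftrightarrow> x \<in> csp_vars I"
    "Inr k \<in> lc_vars (lc_of I) \<longleftrightarrow> k < length (csp_cons I)" for x k
    by (auto simp: lc_of_def)
  have lc_dom: "lc_dom (lc_of I) (Inl x) = Inl ` csp_dom I x"
    "lc_dom (lc_of I) (Inr k) = Inr ` snd (csp_cons I ! k)" for x k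
    by (simp_all add: lc_of_def)
  define u where "u x a = v (Inl x) (Inl a)" for x a
  define w where "w k t = v (Inr k) (Inr t)" for k t
  have u_orth: "(\<Sum>j<N. u x a j * u x b j) = 0"
    if "x \<in> csp_vars I" "a \<in> carrier D4" "b \<in> carrier D4" "a \<noteq> b" for x a b
    using va_orth[of "Inl x" "Inl a" "Inl b"] that by (simp add: lc_vars lc_dom dom u_def)
  have u_sum: "(\<Sum>a\<in>carrier D4. u x a j) = vi j" if "x \<in> csp_vars I" "j < N" for x j
    using va_sum[of "Inl x" j] that by (simp add: lc_vars lc_dom dom u_def sum.reindex)
  obtain ds where ds: "set ds = carrier D4" "distinct ds"
    using finite_distinct_list[OF finite_carrier_D4] by blast
  \<comment> \<open>Two rounds are needed: the identity is a base point for a single variable, but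
    the identity tuple need not lie in a relation. The first round fixes \<open>A\<close> and
    \<open>B\<close> of the base point, the second then fixes \<open>C\<close> of the value.\<close>
  define g where "g x = word D4 N ds (u x) id \<one>\<^bsub>D4\<^esub>" for x
  define s where "s x = word D4 N ds (u x) id (g x)" for x
  have g_closed: "g x \<in> carrier D4" for x
    unfolding g_def by (rule D4.word_closed) (auto simp: ds)
  have s_closed: "s x \<in> carrier D4" for x
    unfolding s_def by (rule D4.word_closed) (auto simp: ds g_closed)
  have sol: "(\<lambda>i\<in>{..<length xs}. s (xs ! i)) \<in> R" if c: "(xs, R) \<in> set (csp_cons I)" for xs R
  proof -
    obtain k where k: "k < length (csp_cons I)" "csp_cons I ! k = (xs, R)"
      using c by (auto simp: in_set_conv_nth)
    let ?P = "product_group {..<length xs} (\<lambda>_. D4)"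
    have grp: "group ?P" by (auto intro: group_D4)
    interpret P: group ?P by (rule grp)
    have coset: "is_coset ?P R" using assms(2) c by (auto simp: D4_coset_csp_def)
    note R = coset_mult_inv_mult[OF grp coset]
    have xs: "xs ! i \<in> csp_vars I" if "i < length xs" for i
      using assms(1) c nth_mem[OF that] by (fastforce simp: csp_instance_def)
    have Rc: "t i \<in> carrier D4" if "t \<in> R" "i < length xs" for t i
      using R(1) that by auto
    have finR: "finite R"
      using R(1) by (rule finite_subset) (auto intro!: finite_PiE finite_carrier_D4)
    obtain ts where ts: "set ts = R" "distinct ts"
      using finite_distinct_list[OF finR] by blast
    \<comment> \<open>Any tuple will do: by \<open>AB_word\<close> the choice does not affect
      \<open>A\<close> and \<open>B\<close> of the coordinates of \<open>h\<close>.\<close>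
    obtain t0 where t0: "t0 \<in> R" using R(2) by blast
    have w_orth: "(\<Sum>j<N. w k a j * w k b j) = 0" if "a \<in> R" "b \<in> R" "a \<noteq> b" for a b
      using va_orth[of "Inr k" "Inr a" "Inr b"] that k by (simp add: lc_vars lc_dom w_def)
    have w_sum: "(\<Sum>t\<in>R. w k t j) = vi j" if "j < N" for j
      using va_sum[of "Inr k" j] that k by (simp add: lc_vars lc_dom w_def sum.reindex)
    have w_total: "(\<Sum>j<N. \<Sum>t\<in>set ts. w k t j) = 1"
      using w_sum vi by (simp add: ts)
    have u_w: "u (xs ! i) a j = (\<Sum>t\<in>{t\<in>R. t i = a}. w k t j)"
      if "i < length xs" "a \<in> carrier D4" "j < N" for i a j
    proof -
      have "(Inl (xs ! i), \<lambda>b. Inl (projr b i), Inr k) \<in> set (lc_cons (lc_of I))"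
        using k that by (force simp: lc_of_def Let_def)
      then have "v (Inl (xs ! i)) (Inl a) j = (\<Sum>b\<in>{b \<in> lc_dom (lc_of I) (Inr k).
          Inl (projr b i) = (Inl a :: (nat \<Rightarrow> nat) + (nat \<Rightarrow> nat \<Rightarrow> nat))}. v (Inr k) b j)"
        using that xs[OF that(1)] by (intro va_marginal) (auto simp: lc_dom dom)
      also have "{b \<in> lc_dom (lc_of I) (Inr k).
          Inl (projr b i) = (Inl a :: (nat \<Rightarrow> nat) + (nat \<Rightarrow> nat \<Rightarrow> nat))} = Inr ` {t\<in>R. t i = a}"
        using k by (auto simp: lc_dom)
      finally show ?thesis by (simp add: sum.reindex u_def w_def)
    qed
    \<comment> \<open>Grouping the tuples of \<open>R\<close> by their \<open>i\<close>-th
      coordinate extends \<open>u_w\<close> from single values to every weight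
      \<open>f\<close>.\<close>
    have marginal: "(\<Sum>t\<in>set ts. w k t j * f (t i)) = (\<Sum>a\<in>set ds. u (xs ! i) a j * f (id a))"
      if "i < length xs" "j < N" for i j f
    proof -
      have "(\<Sum>a\<in>carrier D4. u (xs ! i) a j * f a) =
          (\<Sum>a\<in>carrier D4. \<Sum>t\<in>{t\<in>R. t i = a}. w k t j * f (t i))"
        using that by (intro sum.cong) (auto simp: u_w sum_distrib_right)
      also have "\<dots> = (\<Sum>t\<in>R. w k t j * f (t i))"
        by (rule sum.group) (use finR finite_carrier_D4 Rc that in auto)
      finally show ?thesis by (simp add: ts ds)
    qed
    \<comment> \<open>The first round carried out inside \<open>R\<close>; its coordinates play the
      part of \<open>g\<close>.\<close>
    define h where "h = word ?P N ts (w k) id t0"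
    have h: "h \<in> R"
      unfolding h_def by (rule P.word_in_coset[OF R(1,3) t0]) (auto simp: ts)
    have "word ?P N ts (w k) id h \<in> R"
      by (rule P.word_in_coset[OF R(1,3) h]) (auto simp: ts)
    also have "word ?P N ts (w k) id h = (\<lambda>i\<in>{..<length xs}. s (xs ! i))"
    proof (rule extensionalityI)
      show "word ?P N ts (w k) id h \<in> extensional {..<length xs}"
        using \<open>word ?P N ts (w k) id h \<in> R\<close> R(1) by (auto simp: PiE_def)
      show "(\<lambda>i\<in>{..<length xs}. s (xs ! i)) \<in> extensional {..<length xs}" by simp
      fix i assume "i \<in> {..<length xs}"
      then have i: "i < length xs" by simp
      have ux: "(\<Sum>j<N. \<Sum>a\<in>set ds. u (xs ! i) a j) = 1"
        using u_sum[OF xs[OF i]] vi by (simp add: ds)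
      have word_i: "word ?P N ts (w k) id y i = word D4 N ts (w k) (\<lambda>t. t i) (y i)" if "y \<in> R" for y
        using i that R(1) group_D4 by (subst word_product_group) auto
      have pc: "(\<lambda>t. t i) ` set ts \<subseteq> carrier D4" "id ` set ds \<subseteq> carrier D4"
        using Rc i by (auto simp: ts ds)
      have hi: "h i = word D4 N ts (w k) (\<lambda>t. t i) (t0 i)"
        unfolding h_def by (rule word_i[OF t0])
      \<comment> \<open>The base points \<open>t0 i\<close> and the identity may differ in
        \<open>A\<close> and \<open>B\<close>, but both have dropped out, and only marginals are
        compared.\<close>
      have "D4_A (h i) = D4_A (g (xs ! i))"
        unfolding hi g_def D4.AB_word(1)[OF Rc[OF t0 i] pc(1) ts(2) w_total]
          D4.AB_word(1)[OF D4.one_closed pc(2) ds(2) ux]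
        by (intro sum.cong refl marginal i) auto
      moreover have "D4_B (h i) = D4_B (g (xs ! i))"
        unfolding hi g_def D4.AB_word(2)[OF Rc[OF t0 i] pc(1) ts(2) w_total]
          D4.AB_word(2)[OF D4.one_closed pc(2) ds(2) ux]
        by (intro sum.cong refl marginal i) auto
      ultimately have "word D4 N ts (w k) (\<lambda>t. t i) (h i) = s (xs ! i)"
        unfolding s_def
        by (intro D4.word_eq Rc h i pc ts(2) ds(2) w_total g_closed marginal)
          (auto simp: ts ds w_orth u_orth xs[OF i])
      then show "word ?P N ts (w k) id h i = (\<lambda>i\<in>{..<length xs}. s (xs ! i)) i"
        using i by (simp add: word_i[OF h])
    qed
    finally show ?thesis .
  qed
  have "csp_solution I s"
    using sol s_closed by (auto simp: csp_solution_def dom)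
  then show ?thesis by blast
qed

end
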